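(* Let $\psi_1,\dots,\psi_n$ be spin orbitals with orbital energies $\varepsilon_1,\dots,\varepsilon_n$, i.e. solutions of the Hartree--Fock equations satisfying the standing assumptions given in the context, and let $\mathfrak{p},\mathfrak{q},\mathfrak{s}_{a,c}$ be the functions defined in the context. Let $w$ be a function on $\mathbb{R}^3$ such that its partial derivatives $\partial_jw$, $\partial_j^2w$, $j=1,2,3$, exist almost everywhere, such that $w$ and its second order partial derivatives $\partial_j^2w$, $j=1,2,3$, are in $L_1(\mathbb{R}^3)\cap L_2(\mathbb{R}^3)\cap L_\infty(\mathbb{R}^3)$, and such that $$\nabla^2[\psi_a\ast w](x)=[\psi_a\ast\nabla^2w](x)\qquad (x\in\mathbb{R}^3,\ a=1,\dots,n).$$ Then for $x\in\mathbb{R}^3$ and $a=1,\dots,n$, $$\varepsilon_a[\psi_a\ast w](x)=\left[\left((\mathfrak{q}-\mathfrak{p})\psi_a-2\sum_{c=1}^n\mathfrak{s}_{a,c}\psi_c\right)\ast w\right](x)-[\psi_a\ast\nabla^2w](x),$$ and $\psi_a\ast w$ is in $C_0$ and is uniformly continuous on $\mathbb{R}^3$.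
   Context: All integrals are over $\mathbb{R}^3$; $\nabla^2$ is the Laplace operator on $\mathbb{R}^3$; $\partial_j=\partial/\partial x_j$; $z^{\ast}$ is the complex conjugate of $z$; $(f\ast g)(x)=\int f(s)g(x-s)\,ds$ is convolution; $C_0$ is the set of continuous functions on $\mathbb{R}^3$ that vanish at infinity. The Hartree--Fock equations are $$\left[-\tfrac12\nabla^2-\sum_{j=1}^n\frac{Z_j}{|x-\xi_j|}\right]\psi_a(x)+2\sum_{c=1}^n\int|\psi_c(s)|^2\frac{1}{|x-s|}\,ds\,\psi_a(x)-\sum_{c=1}^n\int\psi_c^{\ast}(s)\psi_a(s)\frac{1}{|x-s|}\,ds\,\psi_c(x)=\varepsilon_a\psi_a(x),$$ for $x\in\mathbb{R}^3$, $a=1,\dots,n$, where $Z_j$ is the atomic number of the nucleus located at $\xi_j\in\mathbb{R}^3$. Standing assumptions on the spin orbitals $\psi_a$: they are continuous functions on $\mathbb{R}^3$, they form an orthonormal set in $L_2(\mathbb{R}^3)$, $|\psi_a(x)|\le 1$ for all $x$, $\nabla^2\psi_a$ is defined everywhere on $\mathbb{R}^3$ except perhaps at the points $\xi_j$, and the partial derivatives $\partial^2\psi_a/\partial x_j^2$, $j=1,2,3$, are essentially bounded. Definitions: $h(x)=|x|^{-1}$, $$\mathfrak{s}_{a,c}(x)=\int\psi_c^{\ast}(s)\psi_a(s)h(x-s)\,ds=[(\psi_c^{\ast}\psi_a)\ast h](x),\qquad \mathfrak{p}(x)=2\sum_{c=1}^nZ_c\,h(x-\xi_c),\qquad \mathf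rak{q}(x)=4\sum_{c=1}^n\mathfrak{s}_{c,c}(x).$$
   Formalization: The left-hand side of the identity is 2ε_a[ψ_a∗w](x) instead of ε_a[ψ_a∗w](x): doubling the Hartree–Fock equations with the given p, q, s gives 2ε_a, and the printed identity fails whenever ε_a(ψ_a∗w) is not zero. *)

theory Defs
  imports "HOL-Analysis.Analysis"
begin

type_synonym space3 = "real ^ 3"

(* Membership in Lebesgue spaces is with respect to the completed measure, so a function
   that is meaningful only almost everywhere (such as a partial derivative) may take
   arbitrary values on the exceptional null set. *)

definition in_L1 :: "(space3 \<Rightarrow> complex) \<Rightarrow> bool" where
  "in_L1 f \<longleftrightarrow> integrable lebesgue f"

definition in_L2 :: "(space3 \<Rightarrow> complex) \<Rightarrow> bool" where
  "in_L2 f \<longleftrightarrow> f \<in> borel_measurable lebesgue \<and> integrable lebesgue (\<lambda>x. (cmod (f x))\<^sup>2)"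

definition in_Linf :: "(space3 \<Rightarrow> complex) \<Rightarrow> bool" where
  "in_Linf f \<longleftrightarrow> f \<in> borel_measurable lebesgue \<and> (\<exists>C. AE x in lebesgue. cmod (f x) \<le> C)"

definition in_C0 :: "(space3 \<Rightarrow> complex) \<Rightarrow> bool" where
  "in_C0 f \<longleftrightarrow> continuous_on UNIV f \<and> (f \<longlongrightarrow> 0) at_infinity"

definition orthonormal_L2 :: "nat set \<Rightarrow> (nat \<Rightarrow> space3 \<Rightarrow> complex) \<Rightarrow> bool" where
  "orthonormal_L2 I \<psi> \<longleftrightarrow>
     (\<forall>a\<in>I. in_L2 (\<psi> a)) \<and>
     (\<forall>a\<in>I. \<forall>c\<in>I. (LINT x|lebesgue. cnj (\<psi> c x) * \<psi> a x) = (if a = c then 1 else 0))"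

definition convolution ::
    "(space3 \<Rightarrow> complex) \<Rightarrow> (space3 \<Rightarrow> complex) \<Rightarrow> space3 \<Rightarrow> complex" (infixl "\<star>" 70) where
  "(f \<star> g) x = (LINT s|lebesgue. f s * g (x - s))"

definition partial_differentiable :: "3 \<Rightarrow> (space3 \<Rightarrow> complex) \<Rightarrow> space3 \<Rightarrow> bool" where
  "partial_differentiable j f x \<longleftrightarrow> (\<lambda>t::real. f (x + t *\<^sub>R axis j 1)) differentiable (at 0)"

definition partial_deriv :: "3 \<Rightarrow> (space3 \<Rightarrow> complex) \<Rightarrow> space3 \<Rightarrow> complex" where
  "partial_deriv j f x = vector_derivative (\<lambda>t::real. f (x + t *\<^sub>R axis j 1)) (at 0)"

(* The j-th second partial derivative exists at x only if the first one exists on a whole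
   neighbourhood of x on the line through x in direction j: otherwise the total function
   partial_deriv j f would be differentiated through its unspecified values. *)
definition partial2_differentiable :: "3 \<Rightarrow> (space3 \<Rightarrow> complex) \<Rightarrow> space3 \<Rightarrow> bool" where
  "partial2_differentiable j f x \<longleftrightarrow>
     (\<forall>\<^sub>F t in nhds (0::real). partial_differentiable j f (x + t *\<^sub>R axis j 1)) \<and>
     partial_differentiable j (partial_deriv j f) x"

definition partial2_deriv :: "3 \<Rightarrow> (space3 \<Rightarrow> complex) \<Rightarrow> space3 \<Rightarrow> complex" where
  "partial2_deriv j f = partial_deriv j (partial_deriv j f)"

definition laplacian :: "(space3 \<Rightarrow> complex) \<Rightarrow> space3 \<Rightarrow> complex" where
  "laplacian f x = (\<Sum>j\<in>UNIV. partial2_deriv j f x)"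

definition coulomb :: "space3 \<Rightarrow> complex" where
  "coulomb x = of_real (1 / norm x)"

definition s_fun :: "(nat \<Rightarrow> space3 \<Rightarrow> complex) \<Rightarrow> nat \<Rightarrow> nat \<Rightarrow> space3 \<Rightarrow> complex" where
  "s_fun \<psi> a c = (\<lambda>s. cnj (\<psi> c s) * \<psi> a s) \<star> coulomb"

definition p_fun :: "nat \<Rightarrow> (nat \<Rightarrow> nat) \<Rightarrow> (nat \<Rightarrow> space3) \<Rightarrow> space3 \<Rightarrow> complex" where
  "p_fun n Z \<xi> x = 2 * (\<Sum>c=1..n. of_nat (Z c) * coulomb (x - \<xi> c))"

definition q_fun :: "nat \<Rightarrow> (nat \<Rightarrow> space3 \<Rightarrow> complex) \<Rightarrow> space3 \<Rightarrow> complex" where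
  "q_fun n \<psi> x = 4 * (\<Sum>c=1..n. s_fun \<psi> c c x)"

(* The equations are imposed off the nuclei \<xi> j only: at a nucleus the Coulomb term is
   singular (in HOL it would be 0) and the Laplacian need not exist.

   Doubling the a-th equation gives
     (q_fun - p_fun) \<psi>\<^sub>a - 2 (\<Sum>c. s_fun a c \<psi>\<^sub>c) - laplacian \<psi>\<^sub>a = 2 \<epsilon>\<^sub>a \<psi>\<^sub>a,
   so an identity written in terms of p_fun, q_fun and s_fun carries 2 \<epsilon>\<^sub>a, not \<epsilon>\<^sub>a. *)
definition hartree_fock ::
    "nat \<Rightarrow> (nat \<Rightarrow> nat) \<Rightarrow> (nat \<Rightarrow> space3) \<Rightarrow> (nat \<Rightarrow> space3 \<Rightarrow> complex) \<Rightarrow> (nat \<Rightarrow> real) \<Rightarrow> bool" where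
  "hartree_fock n Z \<xi> \<psi> \<epsilon> \<longleftrightarrow>
     (\<forall>a\<in>{1..n}. \<forall>x. x \<notin> \<xi> ` {1..n} \<longrightarrow>
        - (1 / 2) * laplacian (\<psi> a) x
        - (\<Sum>j=1..n. of_real (real (Z j) / norm (x - \<xi> j))) * \<psi> a x
        + 2 * (\<Sum>c=1..n. (LINT s|lebesgue. of_real ((cmod (\<psi> c s))\<^sup>2 * (1 / norm (x - s)))) * \<psi> a x)
        - (\<Sum>c=1..n. (LINT s|lebesgue. cnj (\<psi> c s) * \<psi> a s * of_real (1 / norm (x - s))) * \<psi> c x)
        = of_real (\<epsilon> a) * \<psi> a x)"

definition orbital_assumptions ::
    "nat \<Rightarrow> (nat \<Rightarrow> space3) \<Rightarrow> (nat \<Rightarrow> space3 \<Rightarrow> complex) \<Rightarrow> bool" where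
  "orbital_assumptions n \<xi> \<psi> \<longleftrightarrow>
     orthonormal_L2 {1..n} \<psi> \<and>
     (\<forall>a\<in>{1..n}.
        continuous_on UNIV (\<psi> a) \<and>
        (\<forall>x. cmod (\<psi> a x) \<le> 1) \<and>
        (\<forall>x j. x \<notin> \<xi> ` {1..n} \<longrightarrow> partial2_differentiable j (\<psi> a) x) \<and>
        (\<forall>j. in_Linf (partial2_deriv j (\<psi> a))))"

end

theory Submission
  imports Defs
begin

text \<open>Doubling the Hartree--Fock equation, which holds off the finitely many nuclei, and convolving
  it with \<open>w\<close> gives the claimed identity with \<open>laplacian (\<psi> a) \<star> w\<close> in place of
  \<open>\<psi> a \<star> laplacian w\<close>. The potential terms need no separate integrability estimate: up to a
  null set their sum is \<open>2 \<epsilon> \<psi> + laplacian \<psi>\<close>, which is essentially bounded. Both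
  convolutions equal \<open>laplacian (\<psi> a \<star> w)\<close>, the second one by hypothesis, the first one by
  differentiating twice under the integral sign. Decay at infinity follows by splitting the
  convolution integral at \<open>norm s = norm x / 2\<close> and applying Young's inequality to the near part.\<close>

section \<open>Lebesgue measure under reflections, and convolution integrals\<close>

lemma
  fixes y :: "'a::euclidean_space"
  shows measurable_lebesgue_reflect: "(\<lambda>s. y - s) \<in> lebesgue \<rightarrow>\<^sub>M lebesgue"
    and distr_lebesgue_reflect: "distr lebesgue lebesgue (\<lambda>s. y - s) = lebesgue"
proof -
  \<comment> \<open>The reflection is the affine map with factor -1 on every axis; the absolute
    values of these factors multiply to 1, so the density is constantly 1.\<close>
  have T: "y + (\<Sum>j\<in>Basis. (-1 * (x \<bullet> j)) *\<^sub>R j) = y - x" for x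
    by (simp add: sum_negf euclidean_representation)
  show "(\<lambda>s. y - s) \<in> lebesgue \<rightarrow>\<^sub>M lebesgue"
    using lebesgue_affine_measurable[of "\<lambda>_. -1" y] unfolding T by simp
  have "lebesgue = density (distr lebesgue lebesgue (\<lambda>s. y - s)) (\<lambda>_. 1)"
    using lebesgue_affine_euclidean[of "\<lambda>_. -1" y] unfolding T by simp
  then show "distr lebesgue lebesgue (\<lambda>s. y - s) = lebesgue"
    by (simp add: density_1)
qed

lemma lebesgue_integral_reflect:
  fixes F :: "'a::euclidean_space \<Rightarrow> 'b::{banach, second_countable_topology}"
  assumes "F \<in> borel_measurable lebesgue"
  shows "(LINT s|lebesgue. F (y - s)) = (LINT s|lebesgue. F s)"
    and "integrable lebesgue (\<lambda>s. F (y - s)) \<longleftrightarrow> integrable lebesgue F"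
  using integral_distr[OF measurable_lebesgue_reflect assms, of y]
    integrable_distr_eq[OF measurable_lebesgue_reflect assms, of y]
  by (simp_all add: distr_lebesgue_reflect)

lemma AE_lebesgue_reflect:
  fixes y :: "'a::euclidean_space"
  assumes "AE s in lebesgue. P s"
  shows "AE s in lebesgue. P (y - s)"
proof -
  have "AE s in distr lebesgue lebesgue (\<lambda>s. y - s). P s"
    unfolding distr_lebesgue_reflect by (rule assms)
  then show ?thesis
    by (rule AE_distrD[OF measurable_lebesgue_reflect])
qed

text \<open>A translation is a composition of two reflections.\<close>

lemma AE_lebesgue_translate:
  fixes a :: "'a::euclidean_space"
  assumes "AE s in lebesgue. P s"
  shows "AE s in lebesgue. P (s + a)"
  using AE_lebesgue_reflect[OF AE_lebesgue_reflect[OF assms, of 0], of "- a"] by simp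

text \<open>An essential bound on \<open>f\<close> dominates the integrand by a multiple of the
  reflected \<open>w\<close>. The commuted form moves the variable \<open>y\<close> onto
  \<open>f\<close>, the factor whose regularity is known.\<close>

lemma convolution_integrand:
  assumes "in_Linf f" "in_L1 w"
  shows integrable_convolution: "integrable lebesgue (\<lambda>s. f s * w (y - s))"
    and integrable_convolution': "integrable lebesgue (\<lambda>s. f (y - s) * w s)"
    and convolution_commuted: "(f \<star> w) y = (LINT s|lebesgue. f (y - s) * w s)"
proof -
  obtain C where C: "AE x in lebesgue. cmod (f x) \<le> C" and f: "f \<in> borel_measurable lebesgue"
    using assms(1) by (auto simp: in_Linf_def)
  have w: "integrable lebesgue w" and wm: "w \<in> borel_measurable lebesgue"
    using assms(2) by (auto simp: in_L1_def)
  have wy: "(\<lambda>s. w (y - s)) \<in> borel_measurable lebesgue"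
    using measurable_compose[OF measurable_lebesgue_reflect wm] .
  have m: "(\<lambda>s. f s * w (y - s)) \<in> borel_measurable lebesgue"
    using f wy by (rule borel_measurable_times)
  have wy_int: "integrable lebesgue (\<lambda>s. C * cmod (w (y - s)))"
    using lebesgue_integral_reflect(2)[OF wm, of y] w by (auto intro: integrable_norm)
  show 1: "integrable lebesgue (\<lambda>s. f s * w (y - s))"
  proof (rule Bochner_Integration.integrable_bound[OF wy_int m])
    show "AE s in lebesgue. norm (f s * w (y - s)) \<le> norm (C * cmod (w (y - s)))"
      using C
    proof eventually_elim
      case (elim s)
      then have "cmod (f s) * cmod (w (y - s)) \<le> \<bar>C\<bar> * cmod (w (y - s))"
        by (intro mult_right_mono) auto
      then show ?case by (simp add: norm_mult abs_mult)
    qed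
  qed
  show "integrable lebesgue (\<lambda>s. f (y - s) * w s)"
    using lebesgue_integral_reflect(2)[OF m, of y] 1 by simp
  show "(f \<star> w) y = (LINT s|lebesgue. f (y - s) * w s)"
    using lebesgue_integral_reflect(1)[OF m, of y] by (simp add: convolution_def)
qed

section \<open>Differentiation under the convolution integral\<close>

text \<open>Limits of difference quotients are the form to which dominated convergence along
  sequences tending to 0 applies.\<close>

lemma has_vector_derivative_at_0_iff:
  fixes g :: "real \<Rightarrow> 'b::real_normed_vector"
  shows "(g has_vector_derivative d) (at 0) \<longleftrightarrow> ((\<lambda>t. (g t - g 0) /\<^sub>R t) \<longlongrightarrow> d) (at 0)"
proof -
  have "norm (g t - g 0 - t *\<^sub>R d) / norm t = norm ((g t - g 0) /\<^sub>R t - d)" if "t \<noteq> 0" for t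
  proof -
    have "(g t - g 0) /\<^sub>R t - d = (g t - g 0 - t *\<^sub>R d) /\<^sub>R t"
      using that by (simp add: scaleR_diff_right)
    then show ?thesis by (simp add: divide_inverse mult.commute)
  qed
  then have "((\<lambda>t. norm (g t - g 0 - t *\<^sub>R d) / norm t) \<longlongrightarrow> 0) (at 0)
      \<longleftrightarrow> ((\<lambda>t. norm ((g t - g 0) /\<^sub>R t - d)) \<longlongrightarrow> 0) (at 0)"
    by (intro filterlim_cong refl) (auto simp: eventually_at_filter)
  also have "\<dots> \<longleftrightarrow> ((\<lambda>t. (g t - g 0) /\<^sub>R t) \<longlongrightarrow> d) (at 0)"
    by (simp add: tendsto_norm_zero_iff flip: LIM_zero_iff[of _ d])
  finally show ?thesis
    by (simp add: has_vector_derivative_def has_derivative_iff_norm bounded_linear_scaleR_left)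
qed

text \<open>The difference quotients of the convolution are integrals of those of \<open>f\<close>
  against \<open>w\<close>. The Lipschitz bound dominates the integrands by
  \<open>M * cmod (w s)\<close>, which is integrable and independent of the increment; the
  exceptional base points \<open>z\<close> form a null set, which the integral ignores.\<close>

lemma has_vector_derivative_convolution:
  assumes f: "in_Linf f" and w: "in_L1 w" and f': "f' \<in> borel_measurable lebesgue"
    and deriv: "AE z in lebesgue. ((\<lambda>t. f (z + t *\<^sub>R e)) has_vector_derivative f' z) (at 0)"
    and lip: "AE z in lebesgue. \<forall>t. cmod (f (z + t *\<^sub>R e) - f z) \<le> M * \<bar>t\<bar>"
  shows "((\<lambda>t. (f \<star> w) (y + t *\<^sub>R e)) has_vector_derivative (f' \<star> w) y) (at 0)"
proof -
  have wi: "integrable lebesgue w" and wm: "w \<in> borel_measurable lebesgue"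
    using w by (auto simp: in_L1_def)
  have fm: "f \<in> borel_measurable lebesgue"
    using f by (auto simp: in_Linf_def)
  have lim: "((\<lambda>t. (f (z + t *\<^sub>R e) - f z) /\<^sub>R t) \<longlongrightarrow> f' z) (at 0)"
    if "((\<lambda>t. f (z + t *\<^sub>R e)) has_vector_derivative f' z) (at 0)" for z
    using that by (simp add: has_vector_derivative_at_0_iff)
  \<comment> \<open>\<open>f'\<close> comes with measurability only, so the integral is reflected
    directly instead of through \<open>convolution_commuted\<close>, which asks for an essential
    bound.\<close>
  have f'w: "(f' \<star> w) y = (LINT s|lebesgue. f' (y - s) * w s)"
  proof -
    have "(\<lambda>s. f' s * w (y - s)) \<in> borel_measurable lebesgue"
      using f' measurable_compose[OF measurable_lebesgue_reflect wm] by (rule borel_measurable_times)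
    from lebesgue_integral_reflect(1)[OF this, of y] show ?thesis
      by (simp add: convolution_def)
  qed
  have "(\<lambda>i. (LINT s|lebesgue. ((f (y - s + X i *\<^sub>R e) - f (y - s)) /\<^sub>R X i) * w s))
      \<longlonglongrightarrow> (LINT s|lebesgue. f' (y - s) * w s)"
    if X: "\<forall>i. X i \<noteq> 0" "X \<longlonglongrightarrow> 0" for X
  proof (rule integral_dominated_convergence)
    show "(\<lambda>s. f' (y - s) * w s) \<in> borel_measurable lebesgue"
      using measurable_compose[OF measurable_lebesgue_reflect f'] wm by (rule borel_measurable_times)
    show "(\<lambda>s. ((f (y - s + X i *\<^sub>R e) - f (y - s)) /\<^sub>R X i) * w s) \<in> borel_measurable lebesgue" for i
    proof -
      have "(\<lambda>s. f (y - s + X i *\<^sub>R e)) \<in> borel_measurable lebesgue"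
        using measurable_compose[OF measurable_lebesgue_reflect[of "y + X i *\<^sub>R e"] fm]
        by (simp add: algebra_simps)
      moreover have "(\<lambda>s. f (y - s)) \<in> borel_measurable lebesgue"
        by (rule measurable_compose[OF measurable_lebesgue_reflect fm])
      ultimately show ?thesis
        using wm by (intro borel_measurable_times borel_measurable_scaleR borel_measurable_diff) auto
    qed
    show "integrable lebesgue (\<lambda>s. M * cmod (w s))"
      using wi by (auto intro: integrable_norm)
    show "AE s in lebesgue. (\<lambda>i. ((f (y - s + X i *\<^sub>R e) - f (y - s)) /\<^sub>R X i) * w s)
        \<longlonglongrightarrow> f' (y - s) * w s"
      using AE_lebesgue_reflect[OF deriv, of y]
    proof eventually_elim
      case (elim s)
      have "(\<lambda>i. (f (y - s + X i *\<^sub>R e) - f (y - s)) /\<^sub>R X i) \<longlonglongrightarrow> f' (y - s)"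
        using lim[OF elim] X unfolding tendsto_at_iff_sequentially by (auto simp: comp_def)
      then show ?case by (intro tendsto_mult tendsto_const)
    qed
    show "AE s in lebesgue. norm (((f (y - s + X i *\<^sub>R e) - f (y - s)) /\<^sub>R X i) * w s) \<le> M * cmod (w s)" for i
      using AE_lebesgue_reflect[OF lip, of y]
    proof eventually_elim
      case (elim s)
      have "cmod ((f (y - s + X i *\<^sub>R e) - f (y - s)) /\<^sub>R X i) \<le> M"
        using elim[rule_format, of "X i"] X(1) unfolding norm_scaleR
        by (simp add: inverse_eq_divide pos_divide_le_eq)
      then show ?case unfolding norm_mult by (rule mult_right_mono) simp
    qed
  qed
  moreover have diff: "(LINT s|lebesgue. ((f (y - s + t *\<^sub>R e) - f (y - s)) /\<^sub>R t) * w s)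
      = ((f \<star> w) (y + t *\<^sub>R e) - (f \<star> w) y) /\<^sub>R t" for t
  proof -
    have "(f \<star> w) (y + t *\<^sub>R e) - (f \<star> w) y
        = (LINT s|lebesgue. f (y + t *\<^sub>R e - s) * w s - f (y - s) * w s)"
      unfolding convolution_commuted[OF f w]
      by (intro Bochner_Integration.integral_diff[symmetric] integrable_convolution'[OF f w])
    also have "\<dots> /\<^sub>R t = (LINT s|lebesgue. (f (y + t *\<^sub>R e - s) * w s - f (y - s) * w s) /\<^sub>R t)"
      by simp
    finally show ?thesis
      by (simp add: algebra_simps scaleR_conv_of_real)
  qed
  ultimately have "((\<lambda>t. ((f \<star> w) (y + t *\<^sub>R e) - (f \<star> w) y) /\<^sub>R t) \<longlongrightarrow> (f' \<star> w) y) (at 0)"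
    unfolding tendsto_at_iff_sequentially f'w comp_def diff[symmetric] by simp
  then show ?thesis
    by (simp add: has_vector_derivative_at_0_iff)
qed

section \<open>Derivative bounds on the real line, and null sets met by lines\<close>

text \<open>An inequality of Landau type: bounds on a function and on its second derivative control
  the first derivative. The bound on \<open>g''\<close> makes \<open>g'\<close> Lipschitz,
  linearizing \<open>g\<close> over a unit interval then bounds \<open>g'\<close>, and the mean
  value inequality makes \<open>g\<close> Lipschitz.\<close>

lemma bounded_second_derivative_AE:
  fixes g :: "real \<Rightarrow> complex"
  assumes g: "\<And>t. (g has_vector_derivative g' t) (at t)"
    and g': "\<And>t. (g' has_vector_derivative g'' t) (at t)"
    and B: "\<And>t. cmod (g t) \<le> B"
    and C: "AE t in lebesgue. cmod (g'' t) \<le> C" "0 \<le> C"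
  shows "cmod (g' b - g' a) \<le> C * \<bar>b - a\<bar>"
    and "cmod (g' a) \<le> 2 * B + C"
    and "cmod (g b - g a) \<le> (2 * B + C) * \<bar>b - a\<bar>"
proof -
  have "negligible {t. \<not> cmod (g'' t) \<le> C}"
    using C(1) unfolding negligible_iff_null_sets by (simp add: completion.AE_iff_null_sets)
  have le: "cmod (g' b - g' a) \<le> C * (b - a)" if "a \<le> b" for a b
  proof -
    \<comment> \<open>This is the Henstock-Kurzweil integral, which recovers a function from any
      everywhere existing derivative.\<close>
    have "(g'' has_integral (g' b - g' a)) {a..b}"
      using that by (intro fundamental_theorem_of_calculus)
        (auto intro: has_vector_derivative_at_within g')
    \<comment> \<open>Setting \<open>g''\<close> to 0 on the negligible set where it exceeds
      \<open>C\<close> turns the essential bound into a pointwise one.\<close>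
    then have "((\<lambda>t. if cmod (g'' t) \<le> C then g'' t else 0) has_integral (g' b - g' a)) {a..b}"
      using \<open>negligible _\<close> by (rule has_integral_spike[rotated 2]) auto
    then show ?thesis
      using has_integral_bound[of C "\<lambda>t. if cmod (g'' t) \<le> C then g'' t else 0" "g' b - g' a" a b] that C(2)
      by auto
  qed
  show g'_lip: "cmod (g' b - g' a) \<le> C * \<bar>b - a\<bar>" for a b
    using le[of a b] le[of b a] by (cases "a \<le> b") (auto simp: norm_minus_commute)
  show g'_bound: "cmod (g' a) \<le> 2 * B + C" for a
  proof -
    \<comment> \<open>On an interval of length 1 the Lipschitz bound keeps \<open>g'\<close> within
      \<open>C\<close> of \<open>g' a\<close>, so \<open>g' a\<close> differs from
      \<open>g (a + 1) - g a\<close> by at most \<open>C\<close>; the latter is at most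
      \<open>2 * B\<close>.\<close>
    have "norm (g (a + 1) - g a - (a + 1 - a) *\<^sub>R g' a) \<le> norm (a + 1 - a) * C"
    proof (rule vector_differentiable_bound_linearization)
      show "(g has_vector_derivative g' t) (at t within {a..a + 1})" for t
        by (rule has_vector_derivative_at_within[OF g])
      show "norm (g' t - g' a) \<le> C" if "t \<in> {a..a + 1}" for t
        using g'_lip[of t a] that mult_left_mono[of "\<bar>t - a\<bar>" 1 C] C(2) by auto
    qed (auto simp: closed_segment_eq_real_ivl)
    then have "norm (g (a + 1) - g a - g' a) \<le> C"
      by simp
    then show ?thesis
      using B[of a] B[of "a + 1"] norm_triangle_ineq4[of "g (a+1) - g a" "g (a+1) - g a - g' a"]
        norm_triangle_ineq4[of "g (a+1)" "g a"]
      by simp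
  qed
  show "cmod (g b - g a) \<le> (2 * B + C) * \<bar>b - a\<bar>"
  proof -
    have "norm (g b - g a) \<le> (2 * B + C) * norm (b - a)"
    proof (rule differentiable_bound[where S = UNIV])
      show "(g has_derivative (\<lambda>h. h *\<^sub>R g' t)) (at t within UNIV)" for t
        using g[of t] by (simp add: has_vector_derivative_def)
      show "onorm (\<lambda>h. h *\<^sub>R g' t) \<le> 2 * B + C" for t
        using g'_bound[of t] by (intro onorm_le) (simp add: mult.commute[of "\<bar>_\<bar>"] mult_right_mono)
    qed auto
    then show ?thesis by simp
  qed
qed

text \<open>Fubini: for each fixed \<open>t\<close> the translate of the exceptional set is null,
  and the order of the two almost-everywhere quantifiers can be exchanged.\<close>

lemma AE_lebesgue_along_line:
  fixes e :: "'a::euclidean_space"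
  assumes "AE z in lebesgue. P z"
  shows "AE z in lebesgue. AE t in lebesgue. P (z + t *\<^sub>R e)"
proof -
  \<comment> \<open>The exchange requires a set measurable in the product, so the exceptional set is
    enclosed in a Borel null set \<open>N\<close>.\<close>
  have "AE z in lborel. P z"
    using assms by (simp add: AE_completion_iff)
  then obtain N where N: "{z. \<not> P z} \<subseteq> N" "N \<in> null_sets lborel"
    unfolding eventually_ae_filter by auto
  have [measurable]: "N \<in> sets borel"
    using N(2) by auto
  have "AE z in lebesgue. z \<notin> N"
    using AE_not_in[OF N(2)] by (rule AE_completion)
  then have "AE z in lborel. z + t *\<^sub>R e \<notin> N" for t
    using AE_lebesgue_translate[of "\<lambda>z. z \<notin> N" "t *\<^sub>R e"] by (simp add: AE_completion_iff)
  then have "AE t in lborel. AE z in lborel. z + t *\<^sub>R e \<notin> N"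
    by simp
  then have "AE z in lborel. AE t in lborel. z + t *\<^sub>R e \<notin> N"
    by (subst (asm) lborel_pair.AE_commute) measurable
  then have "AE z in lborel. AE t in lborel. P (z + t *\<^sub>R e)"
    using N(1) by (elim eventually_mono) auto
  then show ?thesis
    by (simp add: AE_completion_iff)
qed

text \<open>The base points of lines that hit \<open>X\<close> fill finitely many translates of
  \<open>span {e}\<close>, which has dimension at most 1 and is therefore negligible.\<close>

lemma AE_line_avoids_finite:
  fixes e :: "'a::euclidean_space"
  assumes "finite X" "2 \<le> DIM('a)"
  shows "AE z in lebesgue. \<forall>t. z + t *\<^sub>R e \<notin> X"
proof -
  have "dim {e} < DIM('a)"
    using dim_le_card'[of "{e}"] assms(2) by simp
  then have "negligible (span {e})"
    by (intro negligible_lowdim) simp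
  then have "negligible (\<Union>x\<in>X. (+) x ` span {e})"
    using assms(1) by (intro negligible_Union) (auto intro: negligible_translation)
  then have "AE z in lebesgue. z \<notin> (\<Union>x\<in>X. (+) x ` span {e})"
    unfolding negligible_iff_null_sets by (rule AE_not_in)
  then show ?thesis
  proof (rule eventually_mono)
    fix z assume z: "z \<notin> (\<Union>x\<in>X. (+) x ` span {e})"
    show "\<forall>t. z + t *\<^sub>R e \<notin> X"
    proof (intro allI notI)
      fix t assume "z + t *\<^sub>R e \<in> X"
      moreover have "z = (z + t *\<^sub>R e) + (- t) *\<^sub>R e" "(- t) *\<^sub>R e \<in> span {e}"
        by (simp, intro span_scale span_base singletonI)
      ultimately show False
        using z by blast
    qed
  qed
qed

section \<open>Partial derivatives and the Laplacian of a convolution\<close>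

lemma partial_differentiable_iff_has_vector_derivative:
  "partial_differentiable j f x \<longleftrightarrow>
     ((\<lambda>t. f (x + t *\<^sub>R axis j 1)) has_vector_derivative partial_deriv j f x) (at 0)"
  by (simp add: partial_differentiable_def partial_deriv_def vector_derivative_works)

lemma partial_deriv_eqI:
  "((\<lambda>t. f (x + t *\<^sub>R axis j 1)) has_vector_derivative d) (at 0) \<Longrightarrow> partial_deriv j f x = d"
  by (simp add: partial_deriv_def vector_derivative_at)

text \<open>\<open>partial_deriv\<close> differentiates at parameter 0 only. Taking the point on the
  line as new base point and shifting the parameter yields one function of \<open>t\<close> with a
  derivative at every such \<open>t\<close>, as the one-dimensional bounds require.\<close>

lemma partial_differentiable_along_line:
  assumes "partial_differentiable j f (z + t *\<^sub>R axis j 1)"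
  shows "((\<lambda>t. f (z + t *\<^sub>R axis j 1)) has_vector_derivative
           partial_deriv j f (z + t *\<^sub>R axis j 1)) (at t)"
proof -
  let ?g = "\<lambda>u. f (z + t *\<^sub>R axis j 1 + u *\<^sub>R axis j 1)"
  have "((\<lambda>u. u - t) has_vector_derivative 1) (at t)"
    by (auto intro!: derivative_eq_intros)
  moreover have "(?g has_vector_derivative partial_deriv j f (z + t *\<^sub>R axis j 1)) (at (t - t))"
    using assms by (simp add: partial_differentiable_iff_has_vector_derivative)
  ultimately have "((?g \<circ> (\<lambda>u. u - t)) has_vector_derivative
      1 *\<^sub>R partial_deriv j f (z + t *\<^sub>R axis j 1)) (at t)"
    by (rule vector_diff_chain_at)
  then show ?thesis
    by (simp add: comp_def algebra_simps)
qed

lemma partial2_differentiableD: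
  assumes "partial2_differentiable j f x"
  shows "partial_differentiable j f x" "partial_differentiable j (partial_deriv j f) x"
  \<comment> \<open>The filter \<open>nhds 0\<close>, unlike \<open>at 0\<close>, includes the
    parameter 0, so the first derivative exists at \<open>x\<close> itself.\<close>
  using assms eventually_nhds_x_imp_x[of _ "0::real"]
  by (fastforce simp: partial2_differentiable_def)+

text \<open>Off \<open>X\<close> the derivative is the pointwise limit of Borel difference quotients
  with increments \<open>1 / (i + 1)\<close>; the unspecified values on the null set
  \<open>X\<close> do not affect Lebesgue measurability.\<close>

lemma borel_measurable_partial_deriv:
  assumes "finite X" and f: "f \<in> borel_measurable borel"
    and diff: "\<And>x. x \<notin> X \<Longrightarrow> partial_differentiable j f x"
  shows "partial_deriv j f \<in> borel_measurable lebesgue"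
proof -
  let ?h = "\<lambda>i. 1 / real (Suc i)"
  let ?q = "\<lambda>i x. (f (x + ?h i *\<^sub>R axis j 1) - f x) /\<^sub>R ?h i"
  have "partial_deriv j f \<in> borel_measurable (lebesgue_on (- X))"
  proof (rule borel_measurable_LIMSEQ_metric)
    show "?q i \<in> borel_measurable (lebesgue_on (- X))" for i
    proof -
      have "?q i \<in> borel_measurable borel"
        using f by measurable
      then show ?thesis
        by (intro measurable_restrict_space1 measurable_completion) simp
    qed
    show "(\<lambda>i. ?q i x) \<longlonglongrightarrow> partial_deriv j f x" if "x \<in> space (lebesgue_on (- X))" for x
    proof -
      have "((\<lambda>t. (f (x + t *\<^sub>R axis j 1) - f x) /\<^sub>R t) \<longlongrightarrow> partial_deriv j f x) (at 0)"
        using diff[of x] that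
        by (simp add: partial_differentiable_iff_has_vector_derivative has_vector_derivative_at_0_iff)
      moreover have "?h \<longlonglongrightarrow> 0"
        using LIMSEQ_inverse_real_of_nat unfolding inverse_eq_divide .
      moreover have "\<forall>i. ?h i \<in> UNIV - {0}"
        by simp
      ultimately have "((\<lambda>t. (f (x + t *\<^sub>R axis j 1) - f x) /\<^sub>R t) \<circ> ?h) \<longlonglongrightarrow> partial_deriv j f x"
        unfolding tendsto_at_iff_sequentially by (elim allE[of _ ?h] impE)
      then show ?thesis
        unfolding comp_def .
    qed
  qed
  moreover have "X \<in> null_sets lebesgue"
    using \<open>finite X\<close> negligible_finite negligible_iff_null_sets by blast
  ultimately show ?thesis
    by (simp add: lebesgue_measurable_diff_null)
qed

text \<open>Only almost every line parallel to the axis matters, so the exceptional points, where no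
  derivative need exist, are met by a null set of lines only. On the remaining lines the second
  derivative exists everywhere and is bounded almost everywhere, which suffices for the Lipschitz
  bounds that dominate the difference quotients of the convolution.\<close>

lemma partial2_deriv_convolution:
  assumes "finite X" and cont: "continuous_on UNIV f" and B: "\<And>x. cmod (f x) \<le> B"
    and diff: "\<And>x. x \<notin> X \<Longrightarrow> partial2_differentiable j f x"
    and f2: "in_Linf (partial2_deriv j f)" and w: "in_L1 w"
  shows "partial2_deriv j (f \<star> w) = partial2_deriv j f \<star> w"
proof -
  let ?e = "axis j 1 :: space3"
  obtain C where C: "AE x in lebesgue. cmod (partial2_deriv j f x) \<le> C"
    using f2 by (auto simp: in_Linf_def)
  let ?C = "max C 0"
  have fb: "f \<in> borel_measurable borel"
    using cont by (rule borel_measurable_continuous_onI)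
  then have fm: "f \<in> borel_measurable lebesgue"
    by (intro measurable_completion) simp
  have f_Linf: "in_Linf f"
    using fm B by (auto simp: in_Linf_def)
  have f1m: "partial_deriv j f \<in> borel_measurable lebesgue"
    using borel_measurable_partial_deriv[OF \<open>finite X\<close> fb] diff partial2_differentiableD(1) by blast
  have f2m: "partial2_deriv j f \<in> borel_measurable lebesgue"
    using f2 by (auto simp: in_Linf_def)
  have "AE z in lebesgue. \<forall>t. z + t *\<^sub>R ?e \<notin> X"
    using \<open>finite X\<close> by (rule AE_line_avoids_finite) simp
  moreover have "AE z in lebesgue. AE t in lebesgue. cmod (partial2_deriv j f (z + t *\<^sub>R ?e)) \<le> C"
    using C by (rule AE_lebesgue_along_line)
  \<comment> \<open>Everything is read off at parameter 0 of the line through \<open>z\<close>. The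
    conjuncts are the hypotheses for differentiating the convolution first with \<open>f\<close> and
    then with its first derivative.\<close>
  ultimately have line: "AE z in lebesgue.
      ((\<lambda>t. f (z + t *\<^sub>R ?e)) has_vector_derivative partial_deriv j f z) (at 0) \<and>
      ((\<lambda>t. partial_deriv j f (z + t *\<^sub>R ?e)) has_vector_derivative partial2_deriv j f z) (at 0) \<and>
      (\<forall>t. cmod (f (z + t *\<^sub>R ?e) - f z) \<le> (2 * B + ?C) * \<bar>t\<bar>) \<and>
      (\<forall>t. cmod (partial_deriv j f (z + t *\<^sub>R ?e) - partial_deriv j f z) \<le> ?C * \<bar>t\<bar>) \<and>
      cmod (partial_deriv j f z) \<le> 2 * B + ?C"
  proof eventually_elim
    case (elim z)
    have d1: "((\<lambda>t. f (z + t *\<^sub>R ?e)) has_vector_derivative partial_deriv j f (z + t *\<^sub>R ?e)) (at t)"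
      and d2: "((\<lambda>t. partial_deriv j f (z + t *\<^sub>R ?e)) has_vector_derivative
                 partial2_deriv j f (z + t *\<^sub>R ?e)) (at t)" for t
      using elim(1) diff partial2_differentiableD partial_differentiable_along_line
      unfolding partial2_deriv_def by blast+
    have "AE t in lebesgue. cmod (partial2_deriv j f (z + t *\<^sub>R ?e)) \<le> ?C"
      using elim(2) by (rule eventually_mono) simp
    note bounds = bounded_second_derivative_AE[OF d1 d2 B this]
    show ?case
      using d1[of 0] d2[of 0] bounds(1)[of _ 0] bounds(2)[of 0] bounds(3)[of _ 0] by simp
  qed
  \<comment> \<open>The bound on the first derivative makes it an admissible left factor for the
    second differentiation.\<close>
  have f1_Linf: "in_Linf (partial_deriv j f)"
    unfolding in_Linf_def using f1m line by (auto elim: eventually_mono)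
  have "((\<lambda>t. (f \<star> w) (y + t *\<^sub>R ?e)) has_vector_derivative (partial_deriv j f \<star> w) y) (at 0)" for y
    by (rule has_vector_derivative_convolution[OF f_Linf w f1m, where M = "2 * B + ?C"])
      (use line in \<open>auto elim: eventually_mono\<close>)
  \<comment> \<open>An equality of functions, so that it can be rewritten under the outer derivative
    in \<open>partial2_deriv\<close>.\<close>
  then have 1: "partial_deriv j (f \<star> w) = partial_deriv j f \<star> w"
    by (intro ext partial_deriv_eqI)
  have "((\<lambda>t. (partial_deriv j f \<star> w) (y + t *\<^sub>R ?e)) has_vector_derivative
          (partial2_deriv j f \<star> w) y) (at 0)" for y
    by (rule has_vector_derivative_convolution[OF f1_Linf w f2m, where M = ?C])
      (use line in \<open>auto elim: eventually_mono\<close>)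
  then have "partial_deriv j (partial_deriv j f \<star> w) = partial2_deriv j f \<star> w"
    by (intro ext partial_deriv_eqI)
  then show ?thesis
    by (simp add: partial2_deriv_def 1)
qed

lemma laplacian_convolution:
  assumes "finite X" "continuous_on UNIV f" "\<And>x. cmod (f x) \<le> B"
    and "\<And>x j. x \<notin> X \<Longrightarrow> partial2_differentiable j f x"
    and f2: "\<And>j. in_Linf (partial2_deriv j f)" and w: "in_L1 w"
  shows "laplacian (f \<star> w) x = (laplacian f \<star> w) x"
    and "integrable lebesgue (\<lambda>s. laplacian f s * w (x - s))"
proof -
  have int: "integrable lebesgue (\<lambda>s. partial2_deriv j f s * w (x - s))" for j
    by (rule integrable_convolution[OF f2 w])
  show "integrable lebesgue (\<lambda>s. laplacian f s * w (x - s))"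
    unfolding laplacian_def sum_distrib_right by (intro Bochner_Integration.integrable_sum int)
  have "laplacian (f \<star> w) x = (\<Sum>j\<in>UNIV. (partial2_deriv j f \<star> w) x)"
    unfolding laplacian_def using partial2_deriv_convolution[OF assms(1-4) f2 w] by simp
  also have "\<dots> = (laplacian f \<star> w) x"
    unfolding convolution_def laplacian_def sum_distrib_right
    by (intro Bochner_Integration.integral_sum[symmetric] int)
  finally show "laplacian (f \<star> w) x = (laplacian f \<star> w) x" .
qed

section \<open>Continuity, decay at infinity and uniform continuity\<close>

lemma continuous_on_convolution:
  assumes cont: "continuous_on UNIV f" and B: "\<And>x. cmod (f x) \<le> B" and w: "in_L1 w"
  shows "continuous_on UNIV (f \<star> w)"
proof -
  have fm: "f \<in> borel_measurable lebesgue"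
    using borel_measurable_continuous_onI[OF cont] by (intro measurable_completion) simp
  then have f_Linf: "in_Linf f"
    using B by (auto simp: in_Linf_def)
  have wi: "integrable lebesgue w" and wm: "w \<in> borel_measurable lebesgue"
    using w by (auto simp: in_L1_def)
  have m: "(\<lambda>s. f (y - s) * w s) \<in> borel_measurable lebesgue" for y
    using measurable_compose[OF measurable_lebesgue_reflect fm] wm by (rule borel_measurable_times)
  show ?thesis
    unfolding continuous_on_sequentially
  proof (intro allI ballI impI)
    fix X :: "nat \<Rightarrow> space3" and x
    assume X: "(\<forall>n. X n \<in> UNIV) \<and> X \<longlonglongrightarrow> x"
    have "(\<lambda>n. LINT s|lebesgue. f (X n - s) * w s) \<longlonglongrightarrow> (LINT s|lebesgue. f (x - s) * w s)"
    proof (rule integral_dominated_convergence[OF m m])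
      show "integrable lebesgue (\<lambda>s. B * cmod (w s))"
        using wi by auto
      show "AE s in lebesgue. (\<lambda>n. f (X n - s) * w s) \<longlonglongrightarrow> f (x - s) * w s"
        using X cont by (intro AE_I2 tendsto_intros continuous_on_tendsto_compose[OF cont]) auto
      show "AE s in lebesgue. norm (f (X n - s) * w s) \<le> B * cmod (w s)" for n
        using B by (auto simp: norm_mult mult_right_mono)
    qed
    then show "((f \<star> w) \<circ> X) \<longlonglongrightarrow> (f \<star> w) x"
      by (simp add: comp_def convolution_commuted[OF f_Linf w])
  qed
qed

text \<open>At each fixed \<open>x\<close> the indicator vanishes once \<open>r\<close> exceeds
  \<open>norm x\<close>, so dominated convergence applies with majorant
  \<open>\<bar>h x\<bar>\<close>.\<close>

lemma integral_tail_tendsto_0: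
  fixes h :: "'a::euclidean_space \<Rightarrow> real"
  assumes h: "integrable lebesgue h"
  shows "((\<lambda>r. LINT x|lebesgue. indicator {x. r \<le> norm x} x * h x) \<longlongrightarrow> 0) at_top"
proof -
  have "((\<lambda>r. LINT x|lebesgue. indicator {x. r \<le> norm x} x * h x) \<longlongrightarrow> (LINT x::'a|lebesgue. 0::real)) at_top"
  proof (rule integral_dominated_convergence_at_top)
    show "(\<lambda>x. indicator {x. r \<le> norm x} x * h x) \<in> borel_measurable lebesgue" for r
    proof -
      have "{x::'a. r \<le> norm x} \<in> sets lebesgue"
        by (intro sets_completionI_sets) auto
      then show ?thesis
        using h by (intro borel_measurable_times borel_measurable_indicator) auto
    qed
    show "integrable lebesgue (\<lambda>x. \<bar>h x\<bar>)"
      using h by auto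
    show "\<forall>\<^sub>F r in at_top. AE x in lebesgue. norm (indicator {x. r \<le> norm x} x * h x) \<le> \<bar>h x\<bar>"
      by (auto simp: indicator_def)
    show "AE x in lebesgue. ((\<lambda>r. indicator {x. r \<le> norm x} x * h x) \<longlongrightarrow> 0) at_top"
    proof (intro AE_I2 tendsto_eventually)
      fix x :: 'a
      show "\<forall>\<^sub>F r in at_top. indicator {x. r \<le> norm x} x * h x = 0"
        using eventually_gt_at_top[of "norm x"] by eventually_elim simp
    qed
  qed simp
  then show ?thesis by simp
qed

lemma convolution_tendsto_0_at_infinity:
  assumes f: "in_L2 f" and B: "\<And>x. cmod (f x) \<le> B" and w: "in_L1 w" "in_L2 w"
  shows "((f \<star> w) \<longlongrightarrow> 0) at_infinity"
proof -
  define K where "K = (LINT s|lebesgue. (cmod (w s))\<^sup>2)"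
  define A where "A r = (LINT s|lebesgue. indicator {s. r \<le> norm s} s * (cmod (f s))\<^sup>2)" for r
  define D where "D r = (LINT s|lebesgue. indicator {s. r \<le> norm s} s * cmod (w s))" for r
  have "0 \<le> K"
    by (simp add: K_def)
  have fm: "f \<in> borel_measurable lebesgue" and fi: "integrable lebesgue (\<lambda>s. (cmod (f s))\<^sup>2)"
    using f by (auto simp: in_L2_def)
  have wi: "integrable lebesgue (\<lambda>s. cmod (w s))" and wi2: "integrable lebesgue (\<lambda>s. (cmod (w s))\<^sup>2)"
    using w by (auto simp: in_L1_def in_L2_def)
  have f_Linf: "in_Linf f"
    using fm B by (auto simp: in_Linf_def)
  have tail: "integrable lebesgue (\<lambda>s. indicator {s. r \<le> norm s} s * h s)"
    if "integrable lebesgue h" for h :: "space3 \<Rightarrow> real" and r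
  proof -
    have "{s::space3. r \<le> norm s} \<in> sets lebesgue"
      by (intro sets_completionI_sets) auto
    from integrable_mult_indicator[OF this that] show ?thesis by simp
  qed
  \<comment> \<open>\<open>B * D\<close> accounts for large \<open>s\<close>, where \<open>f\<close>
    is bounded and only the tail of \<open>w\<close> counts. For small \<open>s\<close> the point
    \<open>x - s\<close> is far out, so weighted Young produces the tail \<open>A\<close> of
    \<open>f\<close>; the term \<open>\<delta> * K\<close> does not decay and is made small by the
    choice of \<delta>.\<close>
  have bound: "cmod ((f \<star> w) x) \<le> B * D (norm x / 2) + (\<delta> * K + A (norm x / 2) / \<delta>)"
    if "0 < \<delta>" for x \<delta>
  proof -
    define r where "r = norm x / 2"
    let ?H = "\<lambda>s. indicator {s. r \<le> norm s} s * (cmod (f s))\<^sup>2"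
    have Hm: "?H \<in> borel_measurable lebesgue"
      using tail[OF fi] by auto
    have Hi: "integrable lebesgue (\<lambda>s. ?H (x - s))" and HA: "(LINT s|lebesgue. ?H (x - s)) = A r"
      using lebesgue_integral_reflect[OF Hm, of x] tail[OF fi, of r] by (simp_all add: A_def)
    note ints = tail[OF wi, of r, THEN integrable_mult_right[of B]]
      wi2[THEN integrable_mult_right[of \<delta>]] Hi[THEN integrable_mult_right[of "1 / \<delta>"]]
    have "cmod ((f \<star> w) x) \<le> (LINT s|lebesgue. cmod (f (x - s) * w s))"
      unfolding convolution_commuted[OF f_Linf w(1)] by (rule integral_norm_bound)
    also have "\<dots> \<le> (LINT s|lebesgue. B * (indicator {s. r \<le> norm s} s * cmod (w s))
        + (\<delta> * (cmod (w s))\<^sup>2 + 1 / \<delta> * ?H (x - s)))"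
    proof (rule integral_mono)
      show "integrable lebesgue (\<lambda>s. cmod (f (x - s) * w s))"
        by (intro integrable_norm integrable_convolution'[OF f_Linf w(1)])
      show "integrable lebesgue (\<lambda>s. B * (indicator {s. r \<le> norm s} s * cmod (w s))
          + (\<delta> * (cmod (w s))\<^sup>2 + 1 / \<delta> * ?H (x - s)))"
        by (intro Bochner_Integration.integrable_add ints)
      fix s
      show "cmod (f (x - s) * w s) \<le> B * (indicator {s. r \<le> norm s} s * cmod (w s))
          + (\<delta> * (cmod (w s))\<^sup>2 + 1 / \<delta> * ?H (x - s))"
      proof (cases "r \<le> norm s")
        case True
        have "cmod (f (x - s) * w s) \<le> B * cmod (w s)"
          using B by (simp add: norm_mult mult_right_mono)
        moreover have "0 \<le> \<delta> * (cmod (w s))\<^sup>2 + 1 / \<delta> * ?H (x - s)"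
          using that by (intro add_nonneg_nonneg mult_nonneg_nonneg) auto
        ultimately show ?thesis
          using True by simp
      next
        case False
        then have far: "r \<le> norm (x - s)"
          using norm_triangle_ineq2[of x s] by (simp add: r_def)
        let ?a = "cmod (f (x - s))" and ?b = "cmod (w s)"
        have "?a * ?b \<le> \<delta> * ?b\<^sup>2 + ?a\<^sup>2 / \<delta>"
        proof -
          \<comment> \<open>Adding the nonnegative product leaves the cross term with coefficient
            -1, which is Young's inequality with a cruder constant.\<close>
          have "0 \<le> (\<delta> * ?b - ?a)\<^sup>2 + \<delta> * (?a * ?b)"
            using that by simp
          then have "\<delta> * (?a * ?b) \<le> \<delta> * (\<delta> * ?b\<^sup>2 + ?a\<^sup>2 / \<delta>)"
            using that by (simp add: power2_eq_square algebra_simps)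
          then show ?thesis using that by (simp only: mult_le_cancel_left_pos)
        qed
        then show ?thesis
          using False far by (simp add: norm_mult)
      qed
    qed
    also have "\<dots> = B * D r + (\<delta> * K + 1 / \<delta> * A r)"
      using ints unfolding D_def K_def HA[symmetric]
      by (simp only: Bochner_Integration.integral_add Bochner_Integration.integrable_add
          integral_mult_right_zero)
    finally show ?thesis by (simp add: r_def)
  qed
  show ?thesis
  proof (rule tendstoI)
    fix \<epsilon> :: real assume "0 < \<epsilon>"
    \<comment> \<open>\<open>K + 1\<close> in place of \<open>K\<close> avoids division by 0 and
      makes \<open>\<delta> * K\<close> strictly smaller than half of \<epsilon>.\<close>
    define \<delta> where "\<delta> = \<epsilon> / (2 * (K + 1))"
    have \<delta>: "0 < \<delta>" "\<delta> * K < \<epsilon> / 2"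
      using \<open>0 < \<epsilon>\<close> \<open>0 \<le> K\<close> by (auto simp: \<delta>_def field_simps)
    have "((\<lambda>r. B * D r + A r / \<delta>) \<longlongrightarrow> B * 0 + 0 / \<delta>) at_top"
      unfolding A_def D_def
      by (intro tendsto_add tendsto_mult tendsto_divide tendsto_const integral_tail_tendsto_0 fi wi) (use \<delta> in auto)
    then have "((\<lambda>r. B * D r + A r / \<delta>) \<longlongrightarrow> 0) at_top"
      by simp
    moreover have "filterlim (\<lambda>x::space3. norm x / 2) at_top at_infinity"
      using filterlim_tendsto_pos_mult_at_top[OF tendsto_const, of "1/2" norm at_infinity]
        filterlim_norm_at_top by (simp add: mult.commute)
    ultimately have "((\<lambda>x::space3. B * D (norm x / 2) + A (norm x / 2) / \<delta>) \<longlongrightarrow> 0) at_infinity"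
      by (rule filterlim_compose)
    then have "\<forall>\<^sub>F x::space3 in at_infinity. B * D (norm x / 2) + A (norm x / 2) / \<delta> < \<epsilon> / 2"
      using \<open>0 < \<epsilon>\<close> by (intro order_tendstoD(2)) auto
    then show "\<forall>\<^sub>F x in at_infinity. dist ((f \<star> w) x) 0 < \<epsilon>"
    proof eventually_elim
      case (elim x)
      then have "cmod ((f \<star> w) x) < \<epsilon>"
        using bound[OF \<delta>(1), of x] \<delta>(2) by linarith
      then show ?case by simp
    qed
  qed
qed

text \<open>Two points at distance below 1 either both lie in the compact ball of radius
  \<open>R + 1\<close> or both have norm at least \<open>R\<close>, where the values are below half
  of \<epsilon>. The margin 1 covers pairs straddling the boundary.\<close>

lemma uniformly_continuous_on_in_C0:
  assumes "in_C0 f"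
  shows "uniformly_continuous_on UNIV f"
  unfolding uniformly_continuous_on_def
proof (intro allI impI)
  fix \<epsilon> :: real assume "0 < \<epsilon>"
  have cont: "continuous_on UNIV f" and lim: "(f \<longlongrightarrow> 0) at_infinity"
    using assms by (auto simp: in_C0_def)
  obtain R where R: "\<And>x. R \<le> norm x \<Longrightarrow> cmod (f x) < \<epsilon> / 2"
    using tendstoD[OF lim, of "\<epsilon> / 2"] \<open>0 < \<epsilon>\<close> by (auto simp: eventually_at_infinity)
  have "uniformly_continuous_on (cball 0 (R + 1)) f"
    by (intro compact_uniformly_continuous continuous_on_subset[OF cont]) auto
  then obtain d where "0 < d" and d: "\<And>x y. \<lbrakk>x \<in> cball 0 (R + 1); y \<in> cball 0 (R + 1); dist y x < d\<rbrakk>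
      \<Longrightarrow> dist (f y) (f x) < \<epsilon>"
    using \<open>0 < \<epsilon>\<close> unfolding uniformly_continuous_on_def by blast
  have "dist (f y) (f x) < \<epsilon>" if "dist y x < min d 1" for x y
  proof (cases "norm x \<le> R + 1 \<and> norm y \<le> R + 1")
    case True
    then show ?thesis using d[of x y] that by simp
  next
    case False
    moreover have "\<bar>norm y - norm x\<bar> < 1"
      using norm_triangle_ineq3[of y x] that by (simp add: dist_norm)
    ultimately have "R \<le> norm x" "R \<le> norm y"
      by auto
    then show ?thesis
      using R[of x] R[of y] norm_triangle_ineq4[of "f y" "f x"] by (simp add: dist_norm)
  qed
  then show "\<exists>d>0. \<forall>x\<in>UNIV. \<forall>x'\<in>UNIV. dist x' x < d \<longrightarrow> dist (f x') (f x) < \<epsilon>"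
    using \<open>0 < d\<close> by (intro exI[of _ "min d 1"]) auto
qed

section \<open>The convolved Hartree-Fock equation\<close>

lemma hartree_fock_doubled:
  assumes "hartree_fock n Z \<xi> \<psi> \<epsilon>" "a \<in> {1..n}" "x \<notin> \<xi> ` {1..n}"
  shows "(q_fun n \<psi> x - p_fun n Z \<xi> x) * \<psi> a x - 2 * (\<Sum>c=1..n. s_fun \<psi> a c x * \<psi> c x)
           - laplacian (\<psi> a) x = 2 * of_real (\<epsilon> a) * \<psi> a x"
proof -
  \<comment> \<open>For equal indices the product of an orbital with its conjugate is the squared
    modulus in the direct Coulomb term.\<close>
  have s: "s_fun \<psi> c c x = (LINT s|lebesgue. of_real ((cmod (\<psi> c s))\<^sup>2 * (1 / norm (x - s))))" for c
    unfolding s_fun_def convolution_def coulomb_def of_real_mult complex_norm_square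
    by (simp add: mult.commute)
  have "- (1 / 2) * laplacian (\<psi> a) x
        - (\<Sum>j=1..n. of_real (real (Z j) / norm (x - \<xi> j))) * \<psi> a x
        + 2 * (\<Sum>c=1..n. s_fun \<psi> c c x * \<psi> a x)
        - (\<Sum>c=1..n. s_fun \<psi> a c x * \<psi> c x)
        = of_real (\<epsilon> a) * \<psi> a x"
    using assms unfolding hartree_fock_def s by (simp add: s_fun_def convolution_def coulomb_def)
  moreover have "(\<Sum>j=1..n. of_real (real (Z j) / norm (x - \<xi> j))) = p_fun n Z \<xi> x / 2"
    by (simp add: p_fun_def coulomb_def)
  moreover have "(\<Sum>c=1..n. s_fun \<psi> c c x * \<psi> a x) = q_fun n \<psi> x / 4 * \<psi> a x"
    by (simp add: q_fun_def sum_distrib_right)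
  ultimately have "- (1 / 2) * laplacian (\<psi> a) x - p_fun n Z \<xi> x / 2 * \<psi> a x
        + 2 * (q_fun n \<psi> x / 4 * \<psi> a x) - (\<Sum>c=1..n. s_fun \<psi> a c x * \<psi> c x)
        = of_real (\<epsilon> a) * \<psi> a x"
    by (simp only:)
  then have "2 * (- (1 / 2) * laplacian (\<psi> a) x - p_fun n Z \<xi> x / 2 * \<psi> a x
        + 2 * (q_fun n \<psi> x / 4 * \<psi> a x) - (\<Sum>c=1..n. s_fun \<psi> a c x * \<psi> c x))
        = 2 * (of_real (\<epsilon> a) * \<psi> a x)"
    by (simp only:)
  then show ?thesis
    by (simp add: algebra_simps)
qed

theorem theorem3:
  fixes n :: nat
    and Z :: "nat \<Rightarrow> nat"
    and \<xi> :: "nat \<Rightarrow> space3"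
    and \<psi> :: "nat \<Rightarrow> space3 \<Rightarrow> complex"
    and \<epsilon> :: "nat \<Rightarrow> real"
    and w :: "space3 \<Rightarrow> complex"
  assumes orbitals: "orbital_assumptions n \<xi> \<psi>"
    and HF: "hartree_fock n Z \<xi> \<psi> \<epsilon>"
    and w_partial: "\<And>j. AE x in lebesgue. partial_differentiable j w x"
    and w_partial2: "\<And>j. AE x in lebesgue. partial2_differentiable j w x"
    and w_Lp: "in_L1 w" "in_L2 w" "in_Linf w"
    and w2_Lp: "\<And>j. in_L1 (partial2_deriv j w)" "\<And>j. in_L2 (partial2_deriv j w)"
               "\<And>j. in_Linf (partial2_deriv j w)"
    and laplacian_conv: "\<And>a x. a \<in> {1..n} \<Longrightarrow>
           laplacian (\<psi> a \<star> w) x = (\<psi> a \<star> laplacian w) x"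
  shows "\<forall>a\<in>{1..n}.
           (\<forall>x. 2 * of_real (\<epsilon> a) * (\<psi> a \<star> w) x =
              ((\<lambda>y. (q_fun n \<psi> y - p_fun n Z \<xi> y) * \<psi> a y
                     - 2 * (\<Sum>c=1..n. s_fun \<psi> a c y * \<psi> c y)) \<star> w) x
              - (\<psi> a \<star> laplacian w) x) \<and>
           in_C0 (\<psi> a \<star> w) \<and>
           uniformly_continuous_on UNIV (\<psi> a \<star> w)"
proof (intro ballI conjI allI)
  fix a assume a: "a \<in> {1..n}"
  let ?F = "\<lambda>y. (q_fun n \<psi> y - p_fun n Z \<xi> y) * \<psi> a y - 2 * (\<Sum>c=1..n. s_fun \<psi> a c y * \<psi> c y)"
  have cont: "continuous_on UNIV (\<psi> a)" and bound: "\<And>x. cmod (\<psi> a x) \<le> 1"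
    and diff: "\<And>x j. x \<notin> \<xi> ` {1..n} \<Longrightarrow> partial2_differentiable j (\<psi> a) x"
    and \<psi>2: "\<And>j. in_Linf (partial2_deriv j (\<psi> a))" and L2: "in_L2 (\<psi> a)"
    using orbitals a by (auto simp: orbital_assumptions_def orthonormal_L2_def)
  have Linf: "in_Linf (\<psi> a)"
    using L2 bound by (auto simp: in_Linf_def in_L2_def)
  note lap = laplacian_convolution[of "\<xi> ` {1..n}", OF _ cont bound diff \<psi>2 w_Lp(1)]
  show "2 * of_real (\<epsilon> a) * (\<psi> a \<star> w) x = (?F \<star> w) x - (\<psi> a \<star> laplacian w) x" for x
  proof -
    have "(?F \<star> w) x = (LINT s|lebesgue. 2 * of_real (\<epsilon> a) * (\<psi> a s * w (x - s))
        + laplacian (\<psi> a) s * w (x - s))"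
      unfolding convolution_def
    \<comment> \<open>The integrands agree off the nuclei, a finite and hence null set on which the
      equation says nothing.\<close>
    proof (rule integral_discrete_difference[where X = "\<xi> ` {1..n}"])
      fix s assume "s \<notin> \<xi> ` {1..n}"
      from hartree_fock_doubled[OF HF a this]
      have "?F s = 2 * of_real (\<epsilon> a) * \<psi> a s + laplacian (\<psi> a) s"
        by (simp add: diff_eq_eq)
      then show "?F s * w (x - s)
          = 2 * of_real (\<epsilon> a) * (\<psi> a s * w (x - s)) + laplacian (\<psi> a) s * w (x - s)"
        by (simp only: distrib_right mult.assoc)
    qed (auto intro: countable_finite)
    \<comment> \<open>The integral may be split: one summand is integrable because
      \<open>\<psi> a\<close> is bounded, the other by the second conclusion of
      \<open>laplacian_convolution\<close>.\<close>
    also have "\<dots> = 2 * of_real (\<epsilon> a) * (\<psi> a \<star> w) x + (laplacian (\<psi> a) \<star> w) x"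
      using integrable_convolution[OF Linf w_Lp(1), of x] lap(2)[of x]
      by (simp add: convolution_def)
    also have "(laplacian (\<psi> a) \<star> w) x = (\<psi> a \<star> laplacian w) x"
      using lap(1)[of x] laplacian_conv[OF a, of x] by simp
    finally show ?thesis by simp
  qed
  show C0: "in_C0 (\<psi> a \<star> w)"
    unfolding in_C0_def
    using continuous_on_convolution[OF cont bound w_Lp(1)]
      convolution_tendsto_0_at_infinity[OF L2 bound w_Lp(1,2)] by blast
  show "uniformly_continuous_on UNIV (\<psi> a \<star> w)"
    using C0 by (rule uniformly_continuous_on_in_C0)
qed

end
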